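(* Let $K$ be a finite prism lattice with real-valued discrete $1$-forms (column vectors indexed by the oriented edges), discrete exterior derivatives $d_0$ (vertices to edges) and $d_1$ (edges to $2$-dimensional faces), and discrete Hodge stars $\ast_1,\ast_2$ on $1$-forms and $2$-forms. For discrete $1$-forms $A$ (connection) and $J$ (current) put $$L(A,J)=-\tfrac12\langle dA,dA\rangle+\langle A,J\rangle,\qquad \langle dA,dA\rangle=A^{T}d_1^{T}\ast_2 d_1A,\qquad \langle A,J\rangle=A^{T}\ast_1 J .$$ Let $F=d_1A$ and $\delta F=\ast_1^{-1}d_1^{T}\ast_2F$. Then: (1) For every edge $i$ not lying on the boundary of $K$, the stationarity condition $\partial L(A,J)/\partial A_i=0$ holds if and only if $(\delta F)_i=J_i$. That is, the Euler--Lagrange equations of $L$ are the discrete source equation $\delta F=J$. (2) If $\delta F=J$ holds (at all edges), then the discrete continuity equation $d_0^{T}\ast_1J=0$ holds.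
   Context: A prism lattice is the cell complex obtained as the product of a finite simplicial triangulation of a space manifold (dimension $2$ or $3$) with a subdivision of a time interval into segments; all cells carry fixed orientations. A discrete $k$-form assigns a real number to each oriented $k$-cell, and is identified with a column vector. The discrete exterior derivative $d_k$ from $k$-forms to $(k+1)$-forms is the matrix of signed incidence numbers between $(k+1)$-cells (rows) and $k$-cells (columns); thus $d_{k+1}d_k=0$. The discrete Hodge star $\ast_k$ is the diagonal matrix that scales the value on each $k$-cell by the ratio of the (signed, for the discrete Lorentz metric) volumes of its dual cell and the cell itself; all its diagonal entries are nonzero real numbers, so $\ast_k$ is invertible. *)

theory Defs
  imports "HOL-Analysis.Analysis"
begin

section \<open>Prism lattices\<close>

text \<open>Topological manifold of dimension \<open>n\<close>, possibly with boundary.\<close>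

definition manifold_with_boundary :: "nat \<Rightarrow> 'a topology \<Rightarrow> bool" where
  "manifold_with_boundary n X \<longleftrightarrow>
     Hausdorff_space X \<and> second_countable X \<and>
     (\<forall>x\<in>topspace X. \<exists>U V.
        openin X U \<and> x \<in> U \<and>
        openin (subtopology (Euclidean_space n) {y. 0 \<le> y 0}) V \<and>
        subtopology X U homeomorphic_space subtopology (Euclidean_space n) V)"

text \<open>A cell of the prism lattice is a product of a simplex and a time cell, which is an instant
  \<open>{t j}\<close> or a segment \<open>{t j..t (Suc j)}\<close>; it is recorded as the pair of its two factors.\<close>

type_synonym 'a cell = "'a set \<times> real set"

text \<open>Orientations: \<open>vrank\<close> is an auxiliary total order of the vertices. Together with the direction of
  time it gives every cell a reference orientation (simplices by increasing vertices, segments towards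
  the future, products by the product orientation). The actual, arbitrary orientation of a cell \<open>c\<close>
  is \<open>orient c = 1\<close> or \<open>orient c = -1\<close> times the reference one.

  Metric: \<open>volume c\<close> and \<open>dual_volume c\<close> are the (signed) volumes of the cell \<open>c\<close> and of its dual
  cell. They are part of the data, so that neither the type of dual (circumcentric, barycentric)
  nor the metric and its sign convention is prescribed.\<close>

record 'a prism =
  dimS :: nat
  simplices :: "'a set set"
  steps :: nat
  time :: "nat \<Rightarrow> real"
  vrank :: "'a \<Rightarrow> nat"
  orient :: "'a cell \<Rightarrow> real"
  volume :: "'a cell \<Rightarrow> real"
  dual_volume :: "'a cell \<Rightarrow> real"

definition time_cells :: "('a, 'b) prism_scheme \<Rightarrow> real set set" where
  "time_cells K = {{time K j} |j. j \<le> steps K} \<union> {{time K j..time K (Suc j)} |j. j < steps K}"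

text \<open>The library's simplicial complexes contain the empty simplex, which is not a cell.\<close>

definition all_cells :: "('a, 'b) prism_scheme \<Rightarrow> 'a cell set" where
  "all_cells K = (simplices K - {{}}) \<times> time_cells K"

definition cells :: "('a::euclidean_space, 'b) prism_scheme \<Rightarrow> nat \<Rightarrow> 'a cell set" where
  "cells K k = {(S, I). (S, I) \<in> all_cells K \<and> aff_dim S + aff_dim I = int k}"

definition prism_lattice :: "('a::euclidean_space, 'b) prism_scheme \<Rightarrow> bool" where
  "prism_lattice K \<longleftrightarrow>
     dimS K \<in> {2, 3} \<and>
     simplicial_complex (simplices K) \<and>
     manifold_with_boundary (dimS K) (top_of_set (\<Union>(simplices K))) \<and>
     1 \<le> steps K \<and> strict_mono_on {0..steps K} (time K) \<and>
     inj_on (vrank K) {v. {v} \<in> simplices K} \<and>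
     (\<forall>c\<in>all_cells K. orient K c \<in> {1, -1}) \<and>
     (\<forall>c\<in>all_cells K. volume K c \<noteq> 0 \<and> dual_volume K c \<noteq> 0)"

definition cell_set :: "'a cell \<Rightarrow> ('a \<times> real) set" where
  "cell_set c = fst c \<times> snd c"

text \<open>The lattice has dimension \<open>Suc (dimS K)\<close>; its boundary consists of the codimension-one cells
  that lie in exactly one top-dimensional cell, together with their faces.\<close>

definition on_boundary :: "('a::euclidean_space, 'b) prism_scheme \<Rightarrow> 'a cell \<Rightarrow> bool" where
  "on_boundary K e \<longleftrightarrow>
     (\<exists>f\<in>cells K (dimS K). cell_set e \<subseteq> cell_set f \<and>
        (\<exists>!c. c \<in> cells K (Suc (dimS K)) \<and> cell_set f \<subseteq> cell_set c))"


section \<open>Incidence numbers\<close>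

definition vertices :: "'a::euclidean_space set \<Rightarrow> 'a set" where
  "vertices S = {v. v extreme_point_of S}"

text \<open>Coefficient of \<open>R\<close> in the boundary of the simplex \<open>S\<close> with vertices \<open>v\<^sub>0, \<dots>, v\<^sub>m\<close> in increasing
  order: the face omitting \<open>v\<^sub>i\<close> has the sign \<open>(-1) ^ i\<close>.\<close>

definition simplex_incidence :: "('a::euclidean_space \<Rightarrow> nat) \<Rightarrow> 'a set \<Rightarrow> 'a set \<Rightarrow> real" where
  "simplex_incidence r S R =
     (\<Sum>v\<in>vertices S. if R = convex hull (vertices S - {v})
        then (-1) ^ card {w\<in>vertices S. r w < r v} else 0)"

text \<open>The boundary of a segment is its end minus its beginning; for an instant the two terms cancel.\<close>

definition time_incidence :: "real set \<Rightarrow> real set \<Rightarrow> real" where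
  "time_incidence I J = of_bool (J = {Sup I}) - of_bool (J = {Inf I})"

text \<open>Product rule for the boundary: \<open>\<partial>(S \<times> I) = \<partial>S \<times> I + (-1) ^ dim S * S \<times> \<partial>I\<close>.\<close>

definition incidence :: "('a::euclidean_space, 'b) prism_scheme \<Rightarrow> 'a cell \<Rightarrow> 'a cell \<Rightarrow> real" where
  "incidence K c f = orient K c * orient K f *
     ((if snd c = snd f then simplex_incidence (vrank K) (fst c) (fst f) else 0) +
      (if fst c = fst f then (-1) ^ nat (aff_dim (fst c)) * time_incidence (snd c) (snd f) else 0))"


section \<open>Discrete forms and operators\<close>

text \<open>A discrete \<open>k\<close>-form is a function on cells of which only the values on \<open>cells K k\<close> matter;
  sums over \<open>cells K k\<close> are the matrix products.\<close>

type_synonym 'a form = "'a cell \<Rightarrow> real"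

definition ext_d :: "('a::euclidean_space, 'b) prism_scheme \<Rightarrow> nat \<Rightarrow> 'a form \<Rightarrow> 'a form" where
  "ext_d K k A c = (\<Sum>f\<in>cells K k. incidence K c f * A f)"

definition ext_d_transpose :: "('a::euclidean_space, 'b) prism_scheme \<Rightarrow> nat \<Rightarrow> 'a form \<Rightarrow> 'a form" where
  "ext_d_transpose K k B f = (\<Sum>c\<in>cells K (Suc k). incidence K c f * B c)"

text \<open>The diagonal matrices of the Hodge star and of its inverse, for all degrees at once.\<close>

definition hodge :: "('a, 'b) prism_scheme \<Rightarrow> 'a form \<Rightarrow> 'a form" where
  "hodge K A c = dual_volume K c / volume K c * A c"

definition hodge_inv :: "('a, 'b) prism_scheme \<Rightarrow> 'a form \<Rightarrow> 'a form" where
  "hodge_inv K A c = inverse (dual_volume K c / volume K c) * A c"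

lemma hodge_inverse:
  assumes "prism_lattice K" "c \<in> cells K k"
  shows "hodge K (hodge_inv K A) c = A c" and "hodge_inv K (hodge K A) c = A c"
  using assms by (auto simp: prism_lattice_def cells_def hodge_def hodge_inv_def)

definition pairing :: "('a::euclidean_space, 'b) prism_scheme \<Rightarrow> nat \<Rightarrow> 'a form \<Rightarrow> 'a form \<Rightarrow> real" where
  "pairing K k A B = (\<Sum>c\<in>cells K k. A c * hodge K B c)"

definition lagrangian :: "('a::euclidean_space, 'b) prism_scheme \<Rightarrow> 'a form \<Rightarrow> 'a form \<Rightarrow> real" where
  "lagrangian K A J = - (1/2) * pairing K 2 (ext_d K 1 A) (ext_d K 1 A) + pairing K 1 A J"

definition codiff :: "('a::euclidean_space, 'b) prism_scheme \<Rightarrow> 'a form \<Rightarrow> 'a form" where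
  "codiff K F = hodge_inv K (ext_d_transpose K 1 (hodge K F))"

end

theory Submission
  imports Defs
begin

text \<open>\<open>lagrangian\<close> is quadratic in each edge variable, and its partial derivative at the edge \<open>i\<close> is
  \<open>\<ast>\<^sub>1 (J - \<delta>F)\<close> at \<open>i\<close>. Since \<open>\<ast>\<^sub>1 \<delta>F = d\<^sub>1\<^sup>T \<ast>\<^sub>2 F\<close>, the continuity equation is the transpose of
  \<open>d\<^sub>1 d\<^sub>0 = 0\<close>. For incidence numbers of prisms this follows from the product rule: the boundary of a
  simplex has no boundary, and neither has that of a segment, while the two mixed terms
  \<open>\<partial>S \<times> \<partial>I\<close> come with opposite signs because \<open>\<partial>\<close> lowers the dimension of \<open>S\<close> by one.\<close>

section \<open>Boundaries of simplices\<close>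

lemma vertices_convex_hull:
  assumes "\<not> affine_dependent C"
  shows "vertices (convex hull C) = C"
  using extreme_point_of_convex_hull_affine_independent[OF assms] by (auto simp: vertices_def)

lemma simplex_vertices:
  assumes "n simplex S"
  shows "finite (vertices S)" "\<not> affine_dependent (vertices S)" "convex hull (vertices S) = S"
  using assms by (auto simp: simplex vertices_convex_hull)

lemma vertices_facet:
  assumes "n simplex S"
  shows "vertices (convex hull (vertices S - {v})) = vertices S - {v}"
  using vertices_convex_hull affine_independent_subset simplex_vertices(2)[OF assms] Diff_subset
  by metis

text \<open>Every facet must occur in a sum over \<open>C\<close> for the boundary formula to be
  evaluated there. If \<open>S\<close> is a point, its facet is the empty simplex, also an element
  of \<open>C\<close>.\<close>

lemma facet_in_simplicial_complex:
  assumes "simplicial_complex C" "S \<in> C"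
  shows "convex hull (vertices S - {v}) \<in> C"
proof -
  obtain n where n: "n simplex S"
    using assms by (auto simp: simplicial_complex_def)
  have "convex hull (vertices S - {v}) face_of convex hull (vertices S)"
    using face_of_convex_hull_affine_independent[OF simplex_vertices(2)[OF n]] Diff_subset by metis
  then show ?thesis
    using assms simplex_vertices(3)[OF n] by (auto simp: simplicial_complex_def)
qed

lemma inj_on_vertices:
  assumes "simplicial_complex C" "S \<in> C" "inj_on r {v. {v} \<in> C}"
  shows "inj_on r (vertices S)"
proof -
  have "{v} \<in> C" if "v \<in> vertices S" for v
    using assms(1,2) that face_of_singleton[of v S]
    unfolding simplicial_complex_def vertices_def by blast
  then show ?thesis
    using assms(3) by (auto intro: inj_on_subset)
qed

lemma simplex_incidence_neq_0_imp_facet: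
  assumes "simplex_incidence r S R \<noteq> 0"
  obtains v where "v \<in> vertices S" "R = convex hull (vertices S - {v})"
proof -
  obtain v where "v \<in> vertices S"
      "(if R = convex hull (vertices S - {v}) then (-1) ^ card {w\<in>vertices S. r w < r v} else 0) \<noteq> (0::real)"
    using assms unfolding simplex_incidence_def by (rule sum.not_neutral_contains_not_neutral)
  then show thesis
    using that by (auto split: if_splits)
qed

text \<open>The vertices are affinely independent, so the dimension is their number minus one, and a
  facet omits exactly one of them.\<close>

lemma aff_dim_facet:
  assumes "n simplex S" "simplex_incidence r S R \<noteq> 0"
  shows "aff_dim S = aff_dim R + 1"
proof -
  obtain v where v: "v \<in> vertices S" "R = convex hull (vertices S - {v})"
    using assms(2) by (rule simplex_incidence_neq_0_imp_facet)
  note V = simplex_vertices[OF assms(1)]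
  have "\<not> affine_dependent (vertices S - {v})"
    using V(2) affine_independent_subset by blast
  then have "of_nat (card (vertices S - {v})) = aff_dim R + 1"
    using aff_dim_affine_independent by (metis v(2) aff_dim_convex_hull)
  moreover have "of_nat (card (vertices S)) = aff_dim S + 1"
    using aff_dim_affine_independent[OF V(2)] V(3) by (metis aff_dim_convex_hull)
  moreover have "card (vertices S) = Suc (card (vertices S - {v}))"
    using card.remove[OF V(1) v(1)] .
  ultimately show ?thesis
    by simp
qed

lemma sum_antisymmetric_eq_0:
  fixes f :: "'a \<Rightarrow> 'a \<Rightarrow> real"
  assumes "finite V" "\<And>v w. v \<in> V \<Longrightarrow> w \<in> V \<Longrightarrow> v \<noteq> w \<Longrightarrow> f v w = - f w v"
  shows "(\<Sum>v\<in>V. \<Sum>w\<in>V - {v}. f v w) = 0"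
proof -
  \<comment> \<open>Putting 0 on the diagonal makes both index sets equal to \<open>V\<close>;
    swapping the sums then shows that the total is its own negative.\<close>
  let ?g = "\<lambda>v w. if v = w then 0 else f v w"
  have "(\<Sum>v\<in>V. \<Sum>w\<in>V. ?g v w) = (\<Sum>v\<in>V. \<Sum>w\<in>V. ?g w v)"
    by (rule sum.swap)
  also have "\<dots> = (\<Sum>v\<in>V. \<Sum>w\<in>V. - ?g v w)"
  proof (intro sum.cong refl)
    fix v w assume "v \<in> V" "w \<in> V"
    then show "?g w v = - ?g v w"
      using assms(2)[of w v] by (cases "v = w") simp_all
  qed
  also have "\<dots> = - (\<Sum>v\<in>V. \<Sum>w\<in>V. ?g v w)"
    by (simp only: sum_negf)
  finally have "(\<Sum>v\<in>V. \<Sum>w\<in>V. ?g v w) = 0"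
    by linarith
  moreover have "(\<Sum>w\<in>V - {v}. f v w) = (\<Sum>w\<in>V. ?g v w)" for v
    by (rule sum.mono_neutral_cong_left) (use assms(1) in auto)
  ultimately show ?thesis
    by simp
qed

text \<open>Omitting the earlier vertex \<open>v\<close> moves \<open>w\<close> one place forward,
  whereas omitting \<open>w\<close> leaves the place of \<open>v\<close> unchanged.\<close>

lemma simplex_sign_swap:
  fixes r :: "'a \<Rightarrow> nat"
  assumes "finite V" "v \<in> V" "w \<in> V" "r v < r w"
  shows "(-1::real) ^ card {u\<in>V. r u < r v} * (-1) ^ card {u\<in>V - {v}. r u < r w}
       = - ((-1) ^ card {u\<in>V. r u < r w} * (-1) ^ card {u\<in>V - {w}. r u < r v})"
proof -
  have "{u\<in>V. r u < r w} = insert v {u\<in>V - {v}. r u < r w}"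
    using assms by auto
  then have "card {u\<in>V. r u < r w} = Suc (card {u\<in>V - {v}. r u < r w})"
    using assms by simp
  moreover have "{u\<in>V - {w}. r u < r v} = {u\<in>V. r u < r v}"
    using assms by auto
  ultimately show ?thesis
    by simp
qed

text \<open>A face of codimension two arises by omitting two vertices in either order, and the two
  orders carry opposite signs.\<close>

lemma simplex_boundary_boundary:
  assumes C: "simplicial_complex C" and S: "S \<in> C" and r: "inj_on r {v. {v} \<in> C}"
  shows "(\<Sum>T\<in>C - {{}}. simplex_incidence r S T * simplex_incidence r T R) = 0"
proof -
  obtain n where n: "n simplex S"
    using C S by (auto simp: simplicial_complex_def)
  define V where "V = vertices S"
  \<comment> \<open>\<open>s v U\<close> is the sign of the face omitting \<open>v\<close> from the
    simplex with vertex set \<open>U\<close>; \<open>h v w\<close> is the contribution of omitting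
    first \<open>v\<close>, then \<open>w\<close>.\<close>
  define s where "s v U = (-1::real) ^ card {w\<in>U. r w < r v}" for v U
  define h where "h v w = (if R = convex hull (V - {v} - {w}) then s v V * s w (V - {v}) else 0)"
    for v w
  have fin: "finite V" "finite C"
    using simplex_vertices[OF n] C by (auto simp: V_def simplicial_complex_def)
  have injV: "inj_on r V"
    unfolding V_def using C S r by (rule inj_on_vertices)
  \<comment> \<open>The empty simplex has zero boundary here, so it may be added to the range of
    summation, which then contains all facets of \<open>S\<close>.\<close>
  have "vertices {} = ({}::'a set)"
    by (simp add: vertices_def extreme_point_of_def)
  then have empty: "simplex_incidence r {} R = 0"
    by (simp add: simplex_incidence_def)
  have "(\<Sum>T\<in>C - {{}}. simplex_incidence r S T * simplex_incidence r T R)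
      = (\<Sum>T\<in>C. simplex_incidence r S T * simplex_incidence r T R)"
    by (intro sum.mono_neutral_left) (auto simp: fin empty)
  also have "\<dots> = (\<Sum>T\<in>C. \<Sum>v\<in>V. if T = convex hull (V - {v}) then s v V * simplex_incidence r T R else 0)"
    by (auto simp: simplex_incidence_def[of r S] V_def s_def sum_distrib_right intro!: sum.cong)
  also have "\<dots> = (\<Sum>v\<in>V. \<Sum>T\<in>C. if T = convex hull (V - {v}) then s v V * simplex_incidence r T R else 0)"
    by (rule sum.swap)
  also have "\<dots> = (\<Sum>v\<in>V. s v V * simplex_incidence r (convex hull (V - {v})) R)"
    by (intro sum.cong)
      (use facet_in_simplicial_complex[OF C S] in \<open>auto simp: fin V_def sum.delta\<close>)
  also have "\<dots> = (\<Sum>v\<in>V. \<Sum>w\<in>V - {v}. h v w)"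
    by (intro sum.cong refl)
      (simp add: simplex_incidence_def V_def vertices_facet[OF n] h_def s_def sum_distrib_left if_distrib
        cong: if_cong)
  also have "\<dots> = 0"
  proof (rule sum_antisymmetric_eq_0[OF fin(1)])
    fix v w assume vw: "v \<in> V" "w \<in> V" "v \<noteq> w"
    have "V - {w} - {v} = V - {v} - {w}"
      by auto
    moreover have "s v V * s w (V - {v}) = - (s w V * s v (V - {w}))"
    proof (cases "r v < r w")
      case True
      then show ?thesis
        using simplex_sign_swap[OF fin(1) vw(1,2)] by (simp add: s_def)
    next
      case False
      then have "r w < r v"
        using injV vw by (metis inj_onD nat_neq_iff)
      then show ?thesis
        using simplex_sign_swap[OF fin(1) vw(2,1)] by (simp add: s_def)
    qed
    ultimately show "h v w = - h w v"
      by (simp add: h_def)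
  qed
  finally show ?thesis .
qed


section \<open>Boundaries of time cells\<close>

lemma time_incidence_instant: "time_incidence {t} J = 0"
  by (simp add: time_incidence_def)

lemma time_incidence_neq_0_imp_instant:
  assumes "time_incidence I J \<noteq> 0"
  obtains t where "J = {t}"
  using assms that by (auto simp: time_incidence_def of_bool_def split: if_splits)

text \<open>Each product vanishes by itself, without summation: a nonzero first factor forces
  \<open>J\<close> to be an instant, whose boundary is zero.\<close>

lemma time_boundary_boundary: "time_incidence I J * time_incidence J L = 0"
  by (metis mult_eq_0_iff time_incidence_instant time_incidence_neq_0_imp_instant)

lemma finite_time_cells: "finite (time_cells K)"
  by (simp add: time_cells_def)

lemma aff_dim_time_incidence:
  assumes "strict_mono_on {0..steps K} (time K)" "I \<in> time_cells K" "time_incidence I J \<noteq> 0"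
  shows "aff_dim I = aff_dim J + 1"
proof -
  obtain j where j: "j < steps K" "I = {time K j..time K (Suc j)}"
    using assms(2,3) by (auto simp: time_cells_def time_incidence_instant)
  then have "time K j < time K (Suc j)"
    using assms(1) by (auto simp: strict_mono_on_def)
  then have "interior I \<noteq> {}"
    by (simp add: j)
  then have "aff_dim I = 1"
    using aff_dim_nonempty_interior by fastforce
  moreover obtain t where "J = {t}"
    using assms(3) by (rule time_incidence_neq_0_imp_instant)
  ultimately show ?thesis
    by simp
qed


section \<open>The exterior derivative squares to zero\<close>

lemma finite_all_cells:
  assumes "prism_lattice K"
  shows "finite (all_cells K)"
  using assms finite_time_cells[of K]
  by (simp add: all_cells_def prism_lattice_def simplicial_complex_def)

lemma cells_subset_all_cells: "cells K k \<subseteq> all_cells K"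
  by (auto simp: cells_def)

lemma finite_cells:
  assumes "prism_lattice K"
  shows "finite (cells K k)"
  using finite_subset[OF cells_subset_all_cells finite_all_cells[OF assms]] .

text \<open>This allows sums over cells of one dimension to be extended to
  \<open>all_cells K\<close>, which is a Cartesian product.\<close>

lemma incidence_neq_0_imp_cells:
  assumes K: "prism_lattice K" and c: "c \<in> cells K (Suc k)" and f: "f \<in> all_cells K"
    and nz: "incidence K c f \<noteq> 0"
  shows "f \<in> cells K k"
proof -
  obtain S I R J where [simp]: "c = (S, I)" "f = (R, J)"
    by (cases c, cases f)
  have S: "S \<in> simplices K" "I \<in> time_cells K" "aff_dim S + aff_dim I = int (Suc k)"
    using c by (auto simp: cells_def all_cells_def)
  obtain n where n: "n simplex S"
    using S K by (auto simp: prism_lattice_def simplicial_complex_def)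
  have mono: "strict_mono_on {0..steps K} (time K)"
    using K by (simp add: prism_lattice_def)
  from nz consider "I = J" "simplex_incidence (vrank K) S R \<noteq> 0"
    | "S = R" "time_incidence I J \<noteq> 0"
    by (force simp: incidence_def split: if_splits)
  then have "aff_dim S + aff_dim I = aff_dim R + aff_dim J + 1"
    by cases (use aff_dim_facet[OF n] aff_dim_time_incidence[OF mono S(2)] in auto)
  then show ?thesis
    using S f by (simp add: cells_def)
qed

text \<open>Abstract form of applying the product rule twice, with \<open>p\<close> and
  \<open>q\<close> for the dimension signs of \<open>S\<close> and \<open>R\<close>. The four terms
  are the double boundary in space, the two mixed ones, and the double boundary in time.\<close>

lemma sum_product_rule:
  fixes s s' :: "'a \<Rightarrow> real" and t t' :: "'b \<Rightarrow> real"
  assumes "finite X" "finite Y" "S \<in> X" "R \<in> X" "I \<in> Y" "J \<in> Y"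
  shows "(\<Sum>(T, L)\<in>X \<times> Y. ((if I = L then s T else 0) + (if S = T then p * t L else 0)) *
            ((if L = J then s' T else 0) + (if T = R then q * t' L else 0)))
       = (if I = J then \<Sum>T\<in>X. s T * s' T else 0) + s R * q * t' I + p * t J * s' S
         + (if S = R then p * q * (\<Sum>L\<in>Y. t L * t' L) else 0)"
proof -
  have "(\<Sum>L\<in>Y. ((if I = L then s T else 0) + (if S = T then p * t L else 0)) *
            ((if L = J then s' T else 0) + (if T = R then q * t' L else 0)))
       = (if I = J then s T * s' T else 0) + (if T = R then s T * q * t' I else 0)
         + (if S = T then p * t J * s' T else 0)
         + (if T = S then (if S = R then p * q * (\<Sum>L\<in>Y. t L * t' L) else 0) else 0)" for T
  proof -
    have "(\<Sum>L\<in>Y. ((if I = L then s T else 0) + (if S = T then p * t L else 0)) *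
            ((if L = J then s' T else 0) + (if T = R then q * t' L else 0)))
      = (\<Sum>L\<in>Y. (if L = I then (if I = J then s T * s' T else 0) else 0)
           + (if L = I then (if T = R then s T * q * t' I else 0) else 0)
           + (if L = J then (if S = T then p * t J * s' T else 0) else 0)
           + (if T = S then (if S = R then p * q * (t L * t' L) else 0) else 0))"
      by (intro sum.cong refl) (auto simp: algebra_simps)
    then show ?thesis
      using assms by (simp add: sum.distrib sum.delta sum_distrib_left)
  qed
  then show ?thesis
    using assms
    by (cases "I = J"; cases "S = R") (simp_all add: sum.cartesian_product[symmetric] sum.distrib)
qed

lemma boundary_boundary:
  assumes K: "prism_lattice K" and c: "c \<in> cells K (Suc (Suc k))" and v: "v \<in> cells K k"
  shows "(\<Sum>e\<in>cells K (Suc k). incidence K c e * incidence K e v) = 0"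
proof -
  obtain S I R J where [simp]: "c = (S, I)" "v = (R, J)"
    by (cases c, cases v)
  let ?X = "simplices K - {{}}" and ?Y = "time_cells K"
  let ?\<sigma> = "simplex_incidence (vrank K)"
  let ?\<epsilon> = "\<lambda>T. (-1) ^ nat (aff_dim T) :: real"
  \<comment> \<open>\<open>g\<close> is the product of incidence numbers without orientations. The
    second sign can be taken at \<open>R\<close> because its term requires
    \<open>fst e = R\<close>.\<close>
  define g where "g e = ((if I = snd e then ?\<sigma> S (fst e) else 0)
      + (if S = fst e then ?\<epsilon> S * time_incidence I (snd e) else 0)) *
    ((if snd e = J then ?\<sigma> (fst e) R else 0)
      + (if fst e = R then ?\<epsilon> R * time_incidence (snd e) J else 0))" for e
  have C: "simplicial_complex (simplices K)" and r: "inj_on (vrank K) {v. {v} \<in> simplices K}"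
    using K by (auto simp: prism_lattice_def)
  have S: "S \<in> ?X" "I \<in> ?Y" and R: "R \<in> ?X" "J \<in> ?Y"
    using c v by (auto simp: cells_def all_cells_def)
  obtain n where n: "n simplex S"
    using S C unfolding simplicial_complex_def by blast
  have "incidence K c e * incidence K e v = orient K c * orient K v * g e" if "e \<in> all_cells K" for e
  proof -
    \<comment> \<open>The orientation of the intermediate cell enters twice and cancels.\<close>
    have "orient K e * orient K e = 1"
      using K that by (auto simp: prism_lattice_def)
    moreover have "incidence K c e * incidence K e v
        = orient K e * orient K e * (orient K c * orient K v * g e)"
      unfolding incidence_def g_def by (auto simp: ac_simps)
    ultimately show ?thesis
      by simp
  qed
  then have "(\<Sum>e\<in>all_cells K. incidence K c e * incidence K e v)
      = orient K c * orient K v * (\<Sum>e\<in>?X \<times> ?Y. g e)"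
    by (simp add: sum_distrib_left all_cells_def)
  also have "(\<Sum>e\<in>?X \<times> ?Y. g e) = (\<Sum>(T, L)\<in>?X \<times> ?Y.
      ((if I = L then ?\<sigma> S T else 0) + (if S = T then ?\<epsilon> S * time_incidence I L else 0)) *
      ((if L = J then ?\<sigma> T R else 0) + (if T = R then ?\<epsilon> R * time_incidence L J else 0)))"
    by (simp add: g_def case_prod_unfold)
  also have "\<dots> = (if I = J then \<Sum>T\<in>?X. ?\<sigma> S T * ?\<sigma> T R else 0)
      + ?\<sigma> S R * ?\<epsilon> R * time_incidence I J + ?\<epsilon> S * time_incidence I J * ?\<sigma> S R
      + (if S = R then ?\<epsilon> S * ?\<epsilon> R * (\<Sum>L\<in>?Y. time_incidence I L * time_incidence L J) else 0)"
    using C S R finite_time_cells by (intro sum_product_rule) (auto simp: simplicial_complex_def)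
  also have "\<dots> = ?\<sigma> S R * ?\<epsilon> R * time_incidence I J + ?\<epsilon> S * time_incidence I J * ?\<sigma> S R"
    using simplex_boundary_boundary[OF C _ r] S by (simp add: time_boundary_boundary)
  also have "\<dots> = 0"
  proof (cases "?\<sigma> S R = 0")
    case False
    then have "aff_dim S = aff_dim R + 1"
      using aff_dim_facet[OF n] by blast
    \<comment> \<open>Cells are nonempty. For an empty \<open>R\<close>, \<open>nat\<close> would
      truncate dimension -1 to 0 and the two signs would agree.\<close>
    moreover have "0 \<le> aff_dim R"
      using R aff_dim_negative_iff[of R] by (simp add: not_less[symmetric] del: not_less aff_dim_negative_iff)
    ultimately have "nat (aff_dim S) = Suc (nat (aff_dim R))"
      by simp
    then show ?thesis
      by simp
  qed simp
  finally have "(\<Sum>e\<in>all_cells K. incidence K c e * incidence K e v) = 0"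
    by simp
  moreover have "(\<Sum>e\<in>cells K (Suc k). incidence K c e * incidence K e v)
      = (\<Sum>e\<in>all_cells K. incidence K c e * incidence K e v)"
    using incidence_neq_0_imp_cells[OF K c]
    by (intro sum.mono_neutral_left finite_all_cells K cells_subset_all_cells) auto
  ultimately show ?thesis
    by simp
qed

text \<open>Interchanging the sums exposes the entries of the matrix product, which vanish by
  \<open>boundary_boundary\<close>.\<close>

lemma ext_d_transpose_ext_d_transpose:
  assumes "prism_lattice K" "v \<in> cells K k"
  shows "ext_d_transpose K k (ext_d_transpose K (Suc k) B) v = 0"
proof -
  have "ext_d_transpose K k (ext_d_transpose K (Suc k) B) v
      = (\<Sum>e\<in>cells K (Suc k). \<Sum>c\<in>cells K (Suc (Suc k)). incidence K c e * incidence K e v * B c)"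
    by (simp add: ext_d_transpose_def sum_distrib_left ac_simps)
  also have "\<dots> = (\<Sum>c\<in>cells K (Suc (Suc k)). \<Sum>e\<in>cells K (Suc k). incidence K c e * incidence K e v * B c)"
    by (rule sum.swap)
  also have "\<dots> = 0"
    using assms by (simp add: sum_distrib_right[symmetric] boundary_boundary)
  finally show ?thesis .
qed


section \<open>The Euler--Lagrange equations\<close>

lemma hodge_codiff:
  assumes "prism_lattice K" "e \<in> cells K k"
  shows "hodge K (codiff K F) e = ext_d_transpose K 1 (hodge K F) e"
  using assms by (simp add: codiff_def hodge_inverse)

lemma ext_d_fun_upd:
  assumes "prism_lattice K" "i \<in> cells K k"
  shows "ext_d K k (A(i := s)) c = ext_d K k A c + incidence K c i * (s - A i)"
  using sum.remove[OF finite_cells[OF assms(1)] assms(2), of "\<lambda>f. incidence K c f * (A(i := s)) f"]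
    sum.remove[OF finite_cells[OF assms(1)] assms(2), of "\<lambda>f. incidence K c f * A f"]
  by (simp add: ext_d_def algebra_simps)

lemma pairing_fun_upd:
  assumes "prism_lattice K" "i \<in> cells K k"
  shows "pairing K k (A(i := s)) J = pairing K k A J + (s - A i) * hodge K J i"
  using sum.remove[OF finite_cells[OF assms(1)] assms(2), of "\<lambda>c. (A(i := s)) c * hodge K J c"]
    sum.remove[OF finite_cells[OF assms(1)] assms(2), of "\<lambda>c. A c * hodge K J c"]
  by (simp add: pairing_def algebra_simps)

lemma lagrangian_has_partial_derivative:
  assumes K: "prism_lattice K" and i: "i \<in> cells K 1"
  shows "((\<lambda>s. lagrangian K (A(i := s)) J) has_real_derivative
           hodge K J i - hodge K (codiff K (ext_d K 1 A)) i) (at (A i))"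
proof -
  define w where "w c = dual_volume K c / volume K c" for c
  define F where "F = ext_d K 1 A"
  \<comment> \<open>Expanded around \<open>s = A i\<close>, each square has derivative
    \<open>2 * F c * incidence K c i\<close> there; the factor 2 cancels the one half.\<close>
  have L: "lagrangian K (A(i := s)) J
      = - (1/2) * (\<Sum>c\<in>cells K 2. w c * (F c + incidence K c i * (s - A i))\<^sup>2)
        + (pairing K 1 A J + (s - A i) * hodge K J i)" for s
    unfolding lagrangian_def pairing_fun_upd[OF K i] pairing_def[of K 2] ext_d_fun_upd[OF K i] F_def
    by (simp add: hodge_def w_def power2_eq_square ac_simps)
  have "hodge K (codiff K F) i = (\<Sum>c\<in>cells K 2. w c * (incidence K c i * F c))"
    unfolding hodge_codiff[OF K i]
    by (simp add: ext_d_transpose_def hodge_def w_def ac_simps eval_nat_numeral)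
  then show ?thesis
    unfolding L F_def[symmetric]
    by (auto intro!: derivative_eq_intros simp: sum_distrib_left sum_negf ac_simps)
qed

lemma hodge_eq_iff:
  assumes "prism_lattice K" "c \<in> cells K k"
  shows "hodge K A c = hodge K B c \<longleftrightarrow> A c = B c"
  using assms by (auto simp: prism_lattice_def cells_def hodge_def)

theorem mainTheorem1:
  fixes K :: "'a::euclidean_space prism" and A J :: "'a form"
  assumes "prism_lattice K"
  shows "(\<forall>i\<in>cells K 1. \<not> on_boundary K i \<longrightarrow>
            (((\<lambda>s. lagrangian K (A(i := s)) J) has_real_derivative 0) (at (A i))
              \<longleftrightarrow> codiff K (ext_d K 1 A) i = J i)) \<and>
         ((\<forall>i\<in>cells K 1. codiff K (ext_d K 1 A) i = J i) \<longrightarrow>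
            (\<forall>v\<in>cells K 0. ext_d_transpose K 0 (hodge K J) v = 0))"
proof (intro conjI ballI impI)
  fix i assume i: "i \<in> cells K 1"
  note D = lagrangian_has_partial_derivative[OF assms i, of A J]
  \<comment> \<open>Uniqueness of the derivative turns stationarity into an equation, from which the
    invertible Hodge star is then removed.\<close>
  have "((\<lambda>s. lagrangian K (A(i := s)) J) has_real_derivative 0) (at (A i))
      \<longleftrightarrow> hodge K J i - hodge K (codiff K (ext_d K 1 A)) i = 0"
    using D DERIV_unique[OF D] by metis
  also have "\<dots> \<longleftrightarrow> codiff K (ext_d K 1 A) i = J i"
    using hodge_eq_iff[OF assms i, of J "codiff K (ext_d K 1 A)"] by auto
  finally show "((\<lambda>s. lagrangian K (A(i := s)) J) has_real_derivative 0) (at (A i))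
      \<longleftrightarrow> codiff K (ext_d K 1 A) i = J i" .
next
  fix v assume J: "\<forall>i\<in>cells K 1. codiff K (ext_d K 1 A) i = J i" and v: "v \<in> cells K 0"
  \<comment> \<open>Applying the star to the source equation writes \<open>hodge K J\<close> as a
    transposed derivative, so a second one annihilates it.\<close>
  have "hodge K J e = ext_d_transpose K 1 (hodge K (ext_d K 1 A)) e" if "e \<in> cells K 1" for e
    using hodge_codiff[OF assms that] hodge_eq_iff[OF assms that] J that by metis
  then have "ext_d_transpose K 0 (hodge K J) v
      = ext_d_transpose K 0 (ext_d_transpose K 1 (hodge K (ext_d K 1 A))) v"
    by (simp add: ext_d_transpose_def[of K 0])
  then show "ext_d_transpose K 0 (hodge K J) v = 0"
    using ext_d_transpose_ext_d_transpose[OF assms v] by simp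
qed

end
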